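(* Let $K$ and $L$ be simplicial complexes and let $\varphi_1,\varphi_2,\dots,\varphi_n:K\to L$ be simplicial maps, with geometric realisations $|\varphi_1|,\dots,|\varphi_n|:|K|\to|L|$. Then $\mathrm{D}(|\varphi_1|,\dots,|\varphi_n|)\le\mathrm{SD}(\varphi_1,\dots,\varphi_n)$.
   Context: Simplicial complexes are abstract simplicial complexes. Two simplicial maps $\varphi,\psi:K\to L$ are contiguous if for every simplex $\{v_0,\dots,v_k\}$ of $K$ the set $\{\varphi(v_0),\dots,\varphi(v_k),\psi(v_0),\dots,\psi(v_k)\}$ is a simplex of $L$. They are in the same contiguity class, written $\varphi\sim\psi$, if there is a finite sequence of simplicial maps $K\to L$ from $\varphi$ to $\psi$ in which consecutive maps are contiguous. For simplicial maps $\varphi_1,\dots,\varphi_n:K\to L$, the $n$-th contiguity distance $\mathrm{SD}(\varphi_1,\dots,\varphi_n)$ is the least integer $k\ge 0$ such that $K$ is covered by subcomplexes $K_0,\dots,K_k$ with $\varphi_1|_{K_j},\dots,\varphi_n|_{K_j}:K_j\to L$ all in the same contiguity class for each $j=0,\dots,k$; it is $\infty$ if there is no such covering. For continuous maps $f_1,\dots,f_n:X\to Y$, the $n$-th (higher) homotopic distance $\mathrm{D}(f_1,\dots,f_n)$ is the least integer $k\ge 0$ such that $X$ has an open cover $U_0,\dots,U_k$ with $f_1|_{U_j}\simeq\cdots\simeq f_n|_{U_j}$ (homotopic as maps $U_j\to Y$) for each $j=0,\dots,k$; it is $\infty$ if there is no such cover. *)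

theory Defs
  imports "HOL-Analysis.Analysis" "HOL-Library.Extended_Nat"
begin

section \<open>Abstract simplicial complexes and contiguity\<close>

text \<open>A complex is given by its set of (nonempty) simplices; its vertices are the elements of
  \<open>\<Union>K\<close>. Complexes may be infinite, and the complex without simplices is allowed.\<close>

definition abstract_simplicial_complex :: "'a set set \<Rightarrow> bool" where
  "abstract_simplicial_complex K \<longleftrightarrow>
     (\<forall>\<sigma>\<in>K. finite \<sigma> \<and> \<sigma> \<noteq> {}) \<and> (\<forall>\<sigma>\<in>K. \<forall>\<tau>. \<tau> \<subseteq> \<sigma> \<and> \<tau> \<noteq> {} \<longrightarrow> \<tau> \<in> K)"

definition subcomplex :: "'a set set \<Rightarrow> 'a set set \<Rightarrow> bool" where
  "subcomplex A K \<longleftrightarrow> abstract_simplicial_complex A \<and> A \<subseteq> K"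

text \<open>Vertex maps are total functions on the vertex type. Their values outside \<open>\<Union>K\<close> are irrelevant
  for all notions below, so the restriction of a simplicial map to a subcomplex is
  the same function, regarded as a map on the subcomplex.\<close>

definition simplicial_map :: "'a set set \<Rightarrow> 'b set set \<Rightarrow> ('a \<Rightarrow> 'b) \<Rightarrow> bool" where
  "simplicial_map K L \<phi> \<longleftrightarrow> (\<forall>\<sigma>\<in>K. \<phi> ` \<sigma> \<in> L)"

definition contiguous :: "'a set set \<Rightarrow> 'b set set \<Rightarrow> ('a \<Rightarrow> 'b) \<Rightarrow> ('a \<Rightarrow> 'b) \<Rightarrow> bool" where
  "contiguous K L \<phi> \<psi> \<longleftrightarrow>
     simplicial_map K L \<phi> \<and> simplicial_map K L \<psi> \<and> (\<forall>\<sigma>\<in>K. \<phi> ` \<sigma> \<union> \<psi> ` \<sigma> \<in> L)"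

definition same_contiguity_class ::
  "'a set set \<Rightarrow> 'b set set \<Rightarrow> ('a \<Rightarrow> 'b) \<Rightarrow> ('a \<Rightarrow> 'b) \<Rightarrow> bool" where
  "same_contiguity_class K L \<phi> \<psi> \<longleftrightarrow>
     simplicial_map K L \<phi> \<and> simplicial_map K L \<psi> \<and> (contiguous K L)\<^sup>*\<^sup>* \<phi> \<psi>"

text \<open>The maps are \<open>\<phi> 1, \<dots>, \<phi> n\<close>. The infimum over the empty set is \<open>\<infinity>\<close> in \<^typ>\<open>enat\<close>, and
  otherwise it is the least element.\<close>

definition contiguity_distance ::
  "'a set set \<Rightarrow> 'b set set \<Rightarrow> nat \<Rightarrow> (nat \<Rightarrow> 'a \<Rightarrow> 'b) \<Rightarrow> enat" where
  "contiguity_distance K L n \<phi> =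
     Inf {enat k | k. \<exists>C :: nat \<Rightarrow> 'a set set.
            (\<forall>j\<le>k. subcomplex (C j) K) \<and> (\<Union>j\<le>k. C j) = K \<and>
            (\<forall>j\<le>k. \<forall>p\<in>{1..n}. \<forall>q\<in>{1..n}. same_contiguity_class (C j) L (\<phi> p) (\<phi> q))}"

section \<open>Higher homotopic distance\<close>

definition homotopic_distance ::
  "'a topology \<Rightarrow> 'b topology \<Rightarrow> nat \<Rightarrow> (nat \<Rightarrow> 'a \<Rightarrow> 'b) \<Rightarrow> enat" where
  "homotopic_distance X Y n f =
     Inf {enat k | k. \<exists>U :: nat \<Rightarrow> 'a set.
            (\<forall>j\<le>k. openin X (U j)) \<and> (\<Union>j\<le>k. U j) = topspace X \<and>
            (\<forall>j\<le>k. \<forall>p\<in>{1..n}. \<forall>q\<in>{1..n}.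
               homotopic_with (\<lambda>_. True) (subtopology X (U j)) Y (f p) (f q))}"

section \<open>Geometric realisation\<close>

text \<open>Points of the realisation are given by their barycentric coordinates.\<close>

definition closed_simplex :: "'a set \<Rightarrow> ('a \<Rightarrow> real) set" where
  "closed_simplex \<sigma> = {x. (\<forall>v. 0 \<le> x v) \<and> (\<forall>v. v \<notin> \<sigma> \<longrightarrow> x v = 0) \<and> (\<Sum>v\<in>\<sigma>. x v) = 1}"

definition realisation_carrier :: "'a set set \<Rightarrow> ('a \<Rightarrow> real) set" where
  "realisation_carrier K =
     {x. (\<forall>v. 0 \<le> x v) \<and> {v. x v \<noteq> 0} \<in> K \<and> (\<Sum>v | x v \<noteq> 0. x v) = 1}"

text \<open>The weak (coherent) topology: a set is open iff its trace on every closed simplex is open in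
  that simplex. For finite \<open>\<sigma>\<close> the product topology on \<^typ>\<open>'a \<Rightarrow> real\<close> induces the Euclidean
  topology on \<open>closed_simplex \<sigma>\<close>.\<close>

definition geometric_realisation :: "'a set set \<Rightarrow> ('a \<Rightarrow> real) topology" where
  "geometric_realisation K = topology (\<lambda>U. U \<subseteq> realisation_carrier K \<and>
     (\<forall>\<sigma>\<in>K. openin (top_of_set (closed_simplex \<sigma>)) (U \<inter> closed_simplex \<sigma>)))"

definition realisation_map :: "('a \<Rightarrow> 'b) \<Rightarrow> ('a \<Rightarrow> real) \<Rightarrow> ('b \<Rightarrow> real)" where
  "realisation_map \<phi> x = (\<lambda>w. \<Sum>v | x v \<noteq> 0 \<and> \<phi> v = w. x v)"

lemma openin_geometric_realisation:
  "openin (geometric_realisation K) U \<longleftrightarrow> U \<subseteq> realisation_carrier K \<and>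
     (\<forall>\<sigma>\<in>K. openin (top_of_set (closed_simplex \<sigma>)) (U \<inter> closed_simplex \<sigma>))"
proof -
  have "istopology (\<lambda>U. U \<subseteq> realisation_carrier K \<and>
     (\<forall>\<sigma>\<in>K. openin (top_of_set (closed_simplex \<sigma>)) (U \<inter> closed_simplex \<sigma>)))"
    unfolding istopology_def
  proof (intro conjI allI impI ballI)
    fix S T \<sigma>
    assume S: "S \<subseteq> realisation_carrier K \<and>
      (\<forall>\<sigma>\<in>K. openin (top_of_set (closed_simplex \<sigma>)) (S \<inter> closed_simplex \<sigma>))"
      and T: "T \<subseteq> realisation_carrier K \<and>
      (\<forall>\<sigma>\<in>K. openin (top_of_set (closed_simplex \<sigma>)) (T \<inter> closed_simplex \<sigma>))"
    show "S \<inter> T \<subseteq> realisation_carrier K" using S by blast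
    assume "\<sigma> \<in> K"
    then have "openin (top_of_set (closed_simplex \<sigma>))
        ((S \<inter> closed_simplex \<sigma>) \<inter> (T \<inter> closed_simplex \<sigma>))"
      using S T by blast
    moreover have "(S \<inter> closed_simplex \<sigma>) \<inter> (T \<inter> closed_simplex \<sigma>) = S \<inter> T \<inter> closed_simplex \<sigma>"
      by blast
    ultimately show "openin (top_of_set (closed_simplex \<sigma>)) (S \<inter> T \<inter> closed_simplex \<sigma>)"
      by simp
  next
    fix \<K> \<sigma>
    assume \<K>: "\<forall>S\<in>\<K>. S \<subseteq> realisation_carrier K \<and>
      (\<forall>\<sigma>\<in>K. openin (top_of_set (closed_simplex \<sigma>)) (S \<inter> closed_simplex \<sigma>))"
    show "\<Union>\<K> \<subseteq> realisation_carrier K" using \<K> by blast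
    assume "\<sigma> \<in> K"
    then have "openin (top_of_set (closed_simplex \<sigma>)) (\<Union>S\<in>\<K>. S \<inter> closed_simplex \<sigma>)"
      using \<K> by (intro openin_Union) blast
    moreover have "(\<Union>S\<in>\<K>. S \<inter> closed_simplex \<sigma>) = \<Union>\<K> \<inter> closed_simplex \<sigma>"
      by blast
    ultimately show "openin (top_of_set (closed_simplex \<sigma>)) (\<Union>\<K> \<inter> closed_simplex \<sigma>)"
      by simp
  qed
  then show ?thesis
    unfolding geometric_realisation_def by simp
qed

lemma closed_simplex_subset_realisation_carrier:
  assumes "abstract_simplicial_complex K" "\<sigma> \<in> K"
  shows "closed_simplex \<sigma> \<subseteq> realisation_carrier K"
proof
  fix x assume x: "x \<in> closed_simplex \<sigma>"
  have fin: "finite \<sigma>" using assms unfolding abstract_simplicial_complex_def by blast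
  have sub: "{v. x v \<noteq> 0} \<subseteq> \<sigma>" using x by (auto simp: closed_simplex_def)
  have sum: "(\<Sum>v | x v \<noteq> 0. x v) = 1"
    using x sum.mono_neutral_left[OF fin sub, of x] by (simp add: closed_simplex_def)
  then have "{v. x v \<noteq> 0} \<noteq> {}" by (metis sum.empty zero_neq_one)
  then have "{v. x v \<noteq> 0} \<in> K"
    using assms sub unfolding abstract_simplicial_complex_def by blast
  then show "x \<in> realisation_carrier K"
    using x sum by (simp add: realisation_carrier_def closed_simplex_def)
qed

lemma topspace_geometric_realisation:
  assumes "abstract_simplicial_complex K"
  shows "topspace (geometric_realisation K) = realisation_carrier K"
proof
  show "topspace (geometric_realisation K) \<subseteq> realisation_carrier K"
    using openin_geometric_realisation[of K "topspace (geometric_realisation K)"] by simp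
  have "openin (geometric_realisation K) (realisation_carrier K)"
    unfolding openin_geometric_realisation
  proof (intro conjI ballI)
    fix \<sigma> assume "\<sigma> \<in> K"
    then have "realisation_carrier K \<inter> closed_simplex \<sigma> = closed_simplex \<sigma>"
      using closed_simplex_subset_realisation_carrier[OF assms] by blast
    then show "openin (top_of_set (closed_simplex \<sigma>)) (realisation_carrier K \<inter> closed_simplex \<sigma>)"
      by simp
  qed simp
  then show "realisation_carrier K \<subseteq> topspace (geometric_realisation K)"
    by (rule openin_subset)
qed

end

theory Submission
  imports Defs
begin

text \<open>A covering \<open>C\<^sub>0, \<dots>, C\<^sub>k\<close> of \<open>K\<close> by subcomplexes as in the definition of the contiguity distance
  yields a covering of \<open>|K|\<close> by the closed sets \<open>|C\<^sub>j|\<close>, on which the maps \<open>|\<phi>\<^sub>p|\<close> are homotopic because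
  contiguous maps are joined by straight lines inside simplices of \<open>L\<close>. The homotopic distance asks
  for open sets, so each \<open>|A|\<close>, for \<open>A\<close> a subcomplex of \<open>K\<close>, has to be thickened to an open set on which
  the identity deforms, inside \<open>|K|\<close>, to a map \<open>r\<close> with values in \<open>|A|\<close>. Then on this open set
  \<open>|\<phi>\<^sub>p| \<simeq> |\<phi>\<^sub>p| \<circ> r \<simeq> |\<phi>\<^sub>q| \<circ> r \<simeq> |\<phi>\<^sub>q|\<close>: the outer homotopies come from the deformation
  (\<open>homotopic_push\<close>), the middle one from contiguity on \<open>A\<close> (\<open>homotopic_same_contiguity_class\<close>).

  Usually the thickening is the open star of \<open>A\<close> in the barycentric subdivision. Here it is described
  in barycentric coordinates, without subdividing. Let \<open>c x\<close> (\<open>cut_level\<close>) be the least level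
  \<open>c \<ge> 0\<close> for which the vertices with coordinate above \<open>c\<close> are either absent or span a simplex of \<open>A\<close>.
  The thickening consists of the \<open>x\<close> that have some coordinate above \<open>c x\<close>, equivalently those whose
  largest coordinates are attained on a simplex of \<open>A\<close>. Subtracting \<open>s * c x\<close> from all coordinates,
  cutting off at \<open>0\<close> and normalising gives a deformation (\<open>push\<close>) that starts at \<open>x\<close>, never leaves a
  closed simplex containing \<open>x\<close>, and ends in \<open>|A|\<close>. On each closed simplex \<open>c\<close> is a maximum of finitely
  many minima of coordinates, so everything is continuous there.

  The complexes may be infinite and carry the weak topology, so that continuity of a homotopy
  cannot be read off directly from its continuity on the pieces \<open>[0,1] \<times> |\<sigma>|\<close>. That it suffices to
  consider these pieces is the content of \<open>openin_cylinder\<close>, which rests on the compactness of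
  closed intervals and the tube lemma.\<close>

section \<open>Closed simplices\<close>

lemma continuous_on_coordinate: "continuous_on S (\<lambda>x. x v :: real)"
  by (rule continuous_on_product_then_coordinatewise) (rule continuous_on_id)

lemma closed_closed_simplex: "closed (closed_simplex \<sigma>)"
proof -
  have eq: "closed_simplex \<sigma> = (\<Inter>v. {x. 0 \<le> x v}) \<inter> (\<Inter>v\<in>-\<sigma>. {x. x v = 0}) \<inter> {x. (\<Sum>v\<in>\<sigma>. x v) = 1}"
    by (auto simp: closed_simplex_def)
  show ?thesis
    unfolding eq
    by (intro closed_Int closed_INT ballI closed_Collect_le closed_Collect_eq continuous_on_const
        continuous_on_sum continuous_on_coordinate)
qed

lemma closed_simplexI:
  assumes "\<And>v. 0 \<le> x v" "\<And>v. v \<notin> \<sigma> \<Longrightarrow> x v = 0" "(\<Sum>v\<in>\<sigma>. x v) = 1"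
  shows "x \<in> closed_simplex \<sigma>"
  using assms by (auto simp: closed_simplex_def)

lemma closed_simplexD:
  assumes "x \<in> closed_simplex \<sigma>"
  shows "0 \<le> x v" "v \<notin> \<sigma> \<Longrightarrow> x v = 0" "(\<Sum>v\<in>\<sigma>. x v) = 1"
  using assms by (auto simp: closed_simplex_def)

lemma closed_simplex_mono:
  assumes "finite \<tau>" "\<sigma> \<subseteq> \<tau>"
  shows "closed_simplex \<sigma> \<subseteq> closed_simplex \<tau>"
proof
  fix x assume x: "x \<in> closed_simplex \<sigma>"
  then have "(\<Sum>v\<in>\<tau>. x v) = (\<Sum>v\<in>\<sigma>. x v)"
    using assms by (intro sum.mono_neutral_right) (auto dest: closed_simplexD)
  then show "x \<in> closed_simplex \<tau>"
    using x assms by (intro closed_simplexI) (auto dest: closed_simplexD)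
qed

lemma closed_simplex_convex:
  assumes "x \<in> closed_simplex \<sigma>" "y \<in> closed_simplex \<sigma>" "0 \<le> t" "t \<le> 1"
  shows "(\<lambda>v. (1 - t) * x v + t * y v) \<in> closed_simplex \<sigma>"
proof (rule closed_simplexI)
  show "0 \<le> (1 - t) * x v + t * y v" for v
    using assms by (simp add: closed_simplexD(1))
  show "(1 - t) * x v + t * y v = 0" if "v \<notin> \<sigma>" for v
    using assms that by (simp add: closed_simplexD(2))
  show "(\<Sum>v\<in>\<sigma>. (1 - t) * x v + t * y v) = 1"
    using assms by (simp add: sum.distrib flip: sum_distrib_left) (simp add: closed_simplexD(3))
qed

lemma realisation_carrierD:
  assumes "x \<in> realisation_carrier K"
  shows "{v. x v \<noteq> 0} \<in> K" "x \<in> closed_simplex {v. x v \<noteq> 0}"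
  using assms by (auto simp: realisation_carrier_def closed_simplex_def)

lemma finite_simplex: "abstract_simplicial_complex K \<Longrightarrow> \<sigma> \<in> K \<Longrightarrow> finite \<sigma>"
  by (simp add: abstract_simplicial_complex_def)

lemma simplex_face:
  "abstract_simplicial_complex K \<Longrightarrow> \<sigma> \<in> K \<Longrightarrow> \<tau> \<subseteq> \<sigma> \<Longrightarrow> \<tau> \<noteq> {} \<Longrightarrow> \<tau> \<in> K"
  unfolding abstract_simplicial_complex_def by blast

section \<open>Continuity of homotopies between realisations\<close>

text \<open>Since closed simplices are closed in the product topology, the weak topology and the product
  topology agree on finite unions of them. Finiteness of \<open>F\<close> matters: on infinite unions the weak
  topology can be strictly finer.\<close>

lemma openin_finite_union_closed_simplex:
  assumes V: "openin (geometric_realisation L) V" and F: "finite F" "F \<subseteq> L"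
  shows "openin (top_of_set (\<Union>\<rho>\<in>F. closed_simplex \<rho>)) (V \<inter> (\<Union>\<rho>\<in>F. closed_simplex \<rho>))"
proof -
  have "closed (\<Union>\<rho>\<in>F. closed_simplex \<rho> - V)"
  proof (intro closed_UN F ballI)
    fix \<rho> assume "\<rho> \<in> F"
    then have "openin (top_of_set (closed_simplex \<rho>)) (V \<inter> closed_simplex \<rho>)"
      using V F by (auto simp: openin_geometric_realisation)
    then obtain T where "open T" "V \<inter> closed_simplex \<rho> = closed_simplex \<rho> \<inter> T"
      by (auto simp: openin_open)
    then have "closed_simplex \<rho> - V = closed_simplex \<rho> - T" "closed (closed_simplex \<rho> - T)"
      by (auto intro: closed_Diff closed_closed_simplex)
    then show "closed (closed_simplex \<rho> - V)" by simp
  qed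
  moreover have "V \<inter> (\<Union>\<rho>\<in>F. closed_simplex \<rho>)
      = (\<Union>\<rho>\<in>F. closed_simplex \<rho>) \<inter> - (\<Union>\<rho>\<in>F. closed_simplex \<rho> - V)"
    by blast
  ultimately show ?thesis
    by (simp only: openin_open) blast
qed

text \<open>The product of the weak topology with \<open>[0,1]\<close> is again a weak topology. Around a point
  \<open>(t\<^sub>0, x\<^sub>0)\<close> of \<open>W\<close> one finds a box as follows: \<open>W\<close> contains \<open>J \<times> {x\<^sub>0}\<close> for some compact interval
  \<open>J\<close> around \<open>t\<^sub>0\<close>, and the set of all \<open>x\<close> with \<open>J \<times> {x} \<subseteq> W\<close> is open, because by the tube lemma its
  trace on every closed simplex is.\<close>

lemma openin_cylinder:
  fixes W :: "(real \<times> ('a \<Rightarrow> real)) set"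
  assumes U: "openin (geometric_realisation K) U"
    and W: "W \<subseteq> {0..1} \<times> U"
    and trace: "\<And>\<sigma>. \<sigma> \<in> K \<Longrightarrow>
      openin (top_of_set ({0..1} \<times> (U \<inter> closed_simplex \<sigma>))) (W \<inter> ({0..1} \<times> (U \<inter> closed_simplex \<sigma>)))"
  shows "openin (prod_topology (top_of_set {0..1}) (subtopology (geometric_realisation K) U)) W"
proof (subst openin_subopen, intro ballI)
  fix p assume p: "p \<in> W"
  obtain t0 x0 where p_eq: "p = (t0, x0)" by (cases p)
  have x0U: "x0 \<in> U" and t0: "t0 \<in> {0..1}" using p p_eq W by auto
  then have x0: "x0 \<in> realisation_carrier K"
    using U by (auto simp: openin_geometric_realisation)
  define \<sigma>0 where "\<sigma>0 = {v. x0 v \<noteq> 0}"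
  have \<sigma>0: "\<sigma>0 \<in> K" "x0 \<in> closed_simplex \<sigma>0"
    using realisation_carrierD[OF x0] by (auto simp: \<sigma>0_def)
  obtain O0 where O0: "open O0"
    "W \<inter> ({0..1} \<times> (U \<inter> closed_simplex \<sigma>0)) = ({0..1} \<times> (U \<inter> closed_simplex \<sigma>0)) \<inter> O0"
    using trace[OF \<sigma>0(1)] by (auto simp: openin_open)
  have "open ((\<lambda>t. (t, x0)) -` O0)"
    by (intro open_vimage O0 continuous_intros)
  moreover have "t0 \<in> (\<lambda>t. (t, x0)) -` O0"
    using p p_eq O0(2) x0U t0 \<sigma>0 by auto
  ultimately obtain e where e: "e > 0" "cball t0 e \<subseteq> (\<lambda>t. (t, x0)) -` O0"
    by (meson open_contains_cball)
  define J where "J = {0..1} \<inter> cball t0 e"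
  have J: "compact J" by (auto simp: J_def intro: compact_Int)
  define V where "V = {x\<in>U. \<forall>t\<in>J. (t, x) \<in> W}"
  have "openin (geometric_realisation K) V"
    unfolding openin_geometric_realisation
  proof (intro conjI ballI)
    show "V \<subseteq> realisation_carrier K"
      using U by (auto simp: V_def openin_geometric_realisation)
    fix \<sigma> assume \<sigma>: "\<sigma> \<in> K"
    obtain Q where Q: "open Q"
      "W \<inter> ({0..1} \<times> (U \<inter> closed_simplex \<sigma>)) = ({0..1} \<times> (U \<inter> closed_simplex \<sigma>)) \<inter> Q"
      using trace[OF \<sigma>] by (auto simp: openin_open)
    have U\<sigma>: "openin (top_of_set (closed_simplex \<sigma>)) (U \<inter> closed_simplex \<sigma>)"
      using U \<sigma> by (auto simp: openin_geometric_realisation)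
    show "openin (top_of_set (closed_simplex \<sigma>)) (V \<inter> closed_simplex \<sigma>)"
    proof (subst openin_subopen, intro ballI)
      fix x assume x: "x \<in> V \<inter> closed_simplex \<sigma>"
      have "J \<times> {x} \<subseteq> Q"
        using x Q(2) by (auto simp: V_def J_def)
      then obtain P N where PN: "open P" "open N" "J \<subseteq> P" "x \<in> N" "P \<times> N \<subseteq> Q"
        using tube_lemma_left[of euclidean euclidean Q J x] Q(1) J by auto
      have "openin (top_of_set (closed_simplex \<sigma>)) (U \<inter> closed_simplex \<sigma> \<inter> N)"
        using openin_Int_open[OF U\<sigma> \<open>open N\<close>] by simp
      moreover have "U \<inter> closed_simplex \<sigma> \<inter> N \<subseteq> V \<inter> closed_simplex \<sigma>"
      proof
        fix y assume y: "y \<in> U \<inter> closed_simplex \<sigma> \<inter> N"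
        have "(t, y) \<in> W" if "t \<in> J" for t
        proof -
          have "(t, y) \<in> Q" using PN y that by blast
          then have "(t, y) \<in> ({0..1} \<times> (U \<inter> closed_simplex \<sigma>)) \<inter> Q"
            using y that by (auto simp: J_def)
          then show ?thesis using Q(2) by blast
        qed
        then show "y \<in> V \<inter> closed_simplex \<sigma>" using y by (auto simp: V_def)
      qed
      ultimately show "\<exists>T. openin (top_of_set (closed_simplex \<sigma>)) T \<and> x \<in> T \<and> T \<subseteq> V \<inter> closed_simplex \<sigma>"
        using x PN by (intro exI[of _ "U \<inter> closed_simplex \<sigma> \<inter> N"]) (auto simp: V_def)
    qed
  qed
  then have V: "openin (subtopology (geometric_realisation K) U) V"
    using U by (auto simp: openin_open_subtopology V_def)
  have B: "openin (top_of_set {0..1}) ({0..1} \<inter> ball t0 e)"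
    by (simp add: openin_open_Int)
  have "(t0, x0) \<in> ({0..1} \<inter> ball t0 e) \<times> V"
  proof -
    have "(t, x0) \<in> W" if "t \<in> J" for t
    proof -
      have "(t, x0) \<in> ({0..1} \<times> (U \<inter> closed_simplex \<sigma>0)) \<inter> O0"
        using that e x0U \<sigma>0 by (auto simp: J_def)
      then show ?thesis using O0(2) by blast
    qed
    then show ?thesis using x0U t0 e by (auto simp: V_def)
  qed
  moreover have "({0..1} \<inter> ball t0 e) \<times> V \<subseteq> W"
    by (auto simp: V_def J_def)
  ultimately show "\<exists>T. openin (prod_topology (top_of_set {0..1})
      (subtopology (geometric_realisation K) U)) T \<and> p \<in> T \<and> T \<subseteq> W"
    using B V p_eq by (intro exI[of _ "({0..1} \<inter> ball t0 e) \<times> V"]) (auto simp: openin_prod_Times_iff)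
qed

text \<open>The target also carries the weak topology, so continuity on the pieces is available only for the
  product topology on coordinates. It is enough that each piece is mapped into finitely many closed
  simplices, where the two topologies agree.\<close>

lemma continuous_map_cylinder:
  fixes h :: "real \<times> ('a \<Rightarrow> real) \<Rightarrow> 'b \<Rightarrow> real"
  assumes K: "abstract_simplicial_complex K" and L: "abstract_simplicial_complex L"
    and U: "openin (geometric_realisation K) U"
    and cont: "\<And>\<sigma>. \<sigma> \<in> K \<Longrightarrow> continuous_on ({0..1} \<times> (U \<inter> closed_simplex \<sigma>)) h"
    and carried: "\<And>\<sigma>. \<sigma> \<in> K \<Longrightarrow> \<exists>F. finite F \<and> F \<subseteq> L \<and>
      h ` ({0..1} \<times> (U \<inter> closed_simplex \<sigma>)) \<subseteq> (\<Union>\<rho>\<in>F. closed_simplex \<rho>)"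
  shows "continuous_map (prod_topology (top_of_set {0..1}) (subtopology (geometric_realisation K) U))
    (geometric_realisation L) h"
proof -
  have UK: "U \<subseteq> realisation_carrier K"
    using U by (auto simp: openin_geometric_realisation)
  have top: "topspace (prod_topology (top_of_set {0..1}) (subtopology (geometric_realisation K) U))
      = {0..1} \<times> U"
    using UK by (auto simp: topspace_geometric_realisation[OF K])
  have im: "h (t, x) \<in> realisation_carrier L" if "t \<in> {0..1}" "x \<in> U" for t x
  proof -
    have x: "{v. x v \<noteq> 0} \<in> K" "x \<in> closed_simplex {v. x v \<noteq> 0}"
      using realisation_carrierD that UK by blast+
    obtain F where "F \<subseteq> L" and F:
      "h ` ({0..1} \<times> (U \<inter> closed_simplex {v. x v \<noteq> 0})) \<subseteq> (\<Union>\<rho>\<in>F. closed_simplex \<rho>)"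
      using carried[OF x(1)] by blast
    have "h (t, x) \<in> h ` ({0..1} \<times> (U \<inter> closed_simplex {v. x v \<noteq> 0}))"
      using x(2) that by (intro imageI) simp
    then have "h (t, x) \<in> (\<Union>\<rho>\<in>F. closed_simplex \<rho>)"
      by (rule subsetD[OF F])
    then obtain \<rho> where "\<rho> \<in> L" "h (t, x) \<in> closed_simplex \<rho>"
      using \<open>F \<subseteq> L\<close> by blast
    then show ?thesis
      using closed_simplex_subset_realisation_carrier[OF L] by blast
  qed
  show ?thesis
    unfolding continuous_map top topspace_geometric_realisation[OF L]
  proof (intro conjI allI impI)
    show "h ` ({0..1} \<times> U) \<subseteq> realisation_carrier L" using im by auto
    fix V assume V: "openin (geometric_realisation L) V"
    show "openin (prod_topology (top_of_set {0..1}) (subtopology (geometric_realisation K) U))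
        {p \<in> {0..1} \<times> U. h p \<in> V}"
    proof (rule openin_cylinder[OF U])
      fix \<sigma> assume \<sigma>: "\<sigma> \<in> K"
      obtain F where F: "finite F" "F \<subseteq> L"
        "h ` ({0..1} \<times> (U \<inter> closed_simplex \<sigma>)) \<subseteq> (\<Union>\<rho>\<in>F. closed_simplex \<rho>)"
        using carried[OF \<sigma>] by blast
      have "openin (top_of_set ({0..1} \<times> (U \<inter> closed_simplex \<sigma>)))
          (({0..1} \<times> (U \<inter> closed_simplex \<sigma>)) \<inter> h -` (V \<inter> (\<Union>\<rho>\<in>F. closed_simplex \<rho>)))"
        using F(3)
        by (intro continuous_openin_preimage[OF cont[OF \<sigma>] _
            openin_finite_union_closed_simplex[OF V F(1,2)]]) blast
      moreover have "({0..1} \<times> (U \<inter> closed_simplex \<sigma>)) \<inter> h -` (V \<inter> (\<Union>\<rho>\<in>F. closed_simplex \<rho>))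
          = {p \<in> {0..1} \<times> U. h p \<in> V} \<inter> ({0..1} \<times> (U \<inter> closed_simplex \<sigma>))"
        using F(3) by blast
      ultimately show "openin (top_of_set ({0..1} \<times> (U \<inter> closed_simplex \<sigma>)))
          ({p \<in> {0..1} \<times> U. h p \<in> V} \<inter> ({0..1} \<times> (U \<inter> closed_simplex \<sigma>)))"
        by simp
    qed auto
  qed
qed

section \<open>Realisations of vertex maps on a simplex\<close>

text \<open>On a fixed closed simplex the index set of the defining sum can be chosen independently of the
  point, so that the map is visibly linear there.\<close>

lemma realisation_map_on_simplex:
  assumes "finite \<sigma>" "x \<in> closed_simplex \<sigma>"
  shows "realisation_map \<phi> x w = (\<Sum>v | v \<in> \<sigma> \<and> \<phi> v = w. x v)"
  unfolding realisation_map_def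
  using assms by (intro sum.mono_neutral_left) (auto dest: closed_simplexD(2))

lemma realisation_map_in_simplex:
  assumes "finite \<sigma>" "x \<in> closed_simplex \<sigma>"
  shows "realisation_map \<phi> x \<in> closed_simplex (\<phi> ` \<sigma>)"
proof (rule closed_simplexI)
  note eq = realisation_map_on_simplex[OF assms]
  show "0 \<le> realisation_map \<phi> x w" for w
    using assms unfolding eq by (intro sum_nonneg) (auto dest: closed_simplexD(1))
  show "realisation_map \<phi> x w = 0" if "w \<notin> \<phi> ` \<sigma>" for w
    using that unfolding eq by (intro sum.neutral) auto
  have "(\<Sum>w\<in>\<phi> ` \<sigma>. realisation_map \<phi> x w) = (\<Sum>v\<in>\<sigma>. x v)"
    unfolding eq using sum.image_gen[OF assms(1), of x \<phi>] by simp
  then show "(\<Sum>w\<in>\<phi> ` \<sigma>. realisation_map \<phi> x w) = 1"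
    using assms by (simp add: closed_simplexD(3))
qed

lemma continuous_on_realisation_map_compose:
  assumes "finite \<sigma>" "continuous_on S g" "g ` S \<subseteq> closed_simplex \<sigma>"
  shows "continuous_on S (\<lambda>p. realisation_map \<phi> (g p))"
proof (rule continuous_on_coordinatewise_then_product)
  fix w
  have "continuous_on S (\<lambda>p. \<Sum>v | v \<in> \<sigma> \<and> \<phi> v = w. g p v)"
    by (rule continuous_on_sum) (rule continuous_on_product_then_coordinatewise[OF assms(2)])
  then show "continuous_on S (\<lambda>p. realisation_map \<phi> (g p) w)"
    by (rule continuous_on_eq) (use assms in \<open>auto simp: realisation_map_on_simplex\<close>)
qed

section \<open>Pushing a neighbourhood into a subcomplex\<close>

text \<open>For a complex \<open>A\<close>, the maximum is the least \<open>c \<ge> 0\<close> such that the vertices with coordinate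
  above \<open>c\<close> are absent or form a simplex of \<open>A\<close>: all vertices of a face \<open>\<tau>\<close> lie above \<open>c\<close> exactly if
  the minimum over \<open>\<tau>\<close> exceeds \<open>c\<close>, and this must be avoided for the faces outside \<open>A\<close>. The entry
  \<open>0\<close> makes the level of a point of \<open>|A|\<close> equal to \<open>0\<close>.\<close>

definition cut_level :: "'a set set \<Rightarrow> ('a \<Rightarrow> real) \<Rightarrow> real" where
  "cut_level A x = Max (insert 0 ((\<lambda>\<tau>. Min (x ` \<tau>)) ` {\<tau>. \<tau> \<subseteq> {v. x v \<noteq> 0} \<and> \<tau> \<noteq> {} \<and> \<tau> \<notin> A}))"

text \<open>The points for which the truncation at the cut level leaves something to normalise. For a
  subcomplex \<open>A\<close> this is the union of the open stars, in the barycentric subdivision of \<open>K\<close>, of the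
  barycentres of the simplices of \<open>A\<close>.\<close>

definition push_nbhd :: "'a set set \<Rightarrow> 'a set set \<Rightarrow> ('a \<Rightarrow> real) set" where
  "push_nbhd K A = {x \<in> realisation_carrier K. \<exists>v. cut_level A x < x v}"

definition push :: "'a set set \<Rightarrow> real \<Rightarrow> ('a \<Rightarrow> real) \<Rightarrow> ('a \<Rightarrow> real)" where
  "push A s x = (\<lambda>v. max 0 (x v - s * cut_level A x)
      / (\<Sum>w | x w \<noteq> 0. max 0 (x w - s * cut_level A x)))"

text \<open>A face that leaves the support of \<open>x\<close> contains a vertex with coordinate \<open>0\<close> and contributes only
  the value \<open>0\<close>. Hence the faces of the support may be replaced by the faces of \<open>\<sigma>\<close>, which do not
  depend on \<open>x\<close>; continuity on the closed simplex becomes evident.\<close>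

lemma cut_level_on_simplex:
  assumes fin: "finite \<sigma>" and x: "x \<in> closed_simplex \<sigma>"
  shows "cut_level A x = Max (insert 0 ((\<lambda>\<tau>. Min (x ` \<tau>)) ` {\<tau>. \<tau> \<subseteq> \<sigma> \<and> \<tau> \<noteq> {} \<and> \<tau> \<notin> A}))"
proof -
  define S where "S = {v. x v \<noteq> 0}"
  have S: "S \<subseteq> \<sigma>" using x by (auto simp: S_def dest: closed_simplexD)
  define M where "M = (\<lambda>\<rho>. insert 0 ((\<lambda>\<tau>. Min (x ` \<tau>)) ` {\<tau>. \<tau> \<subseteq> \<rho> \<and> \<tau> \<noteq> {} \<and> \<tau> \<notin> A}))"
  have "M \<sigma> = M S"
  proof
    show "M S \<subseteq> M \<sigma>" using S by (auto simp: M_def)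
    show "M \<sigma> \<subseteq> M S"
    proof
      fix m assume m: "m \<in> M \<sigma>"
      show "m \<in> M S"
      proof (cases "m = 0")
        case True then show ?thesis by (simp add: M_def)
      next
        case False
        then obtain \<tau> where \<tau>: "\<tau> \<subseteq> \<sigma>" "\<tau> \<noteq> {}" "\<tau> \<notin> A" "m = Min (x ` \<tau>)"
          using m by (auto simp: M_def)
        have fin\<tau>: "finite \<tau>" using \<tau> fin finite_subset by blast
        then have "0 \<le> m"
          using \<tau> x by (auto simp: closed_simplexD(1))
        moreover have "m \<le> x v" if "v \<in> \<tau>" for v
          using \<tau> fin\<tau> that by simp
        ultimately have "\<tau> \<subseteq> S" using False by (force simp: S_def)
        then show ?thesis using \<tau> by (auto simp: M_def)
      qed
    qed
  qed
  then show ?thesis by (simp add: cut_level_def M_def S_def)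
qed

lemma cut_level_nonneg:
  assumes "finite \<sigma>" "x \<in> closed_simplex \<sigma>"
  shows "0 \<le> cut_level A x"
  unfolding cut_level_on_simplex[OF assms] using assms by (intro Max_ge) auto

text \<open>If the set of vertices above the level were a face outside \<open>A\<close>, then its minimal coordinate
  would be one of the values whose maximum is the level, although it exceeds the level.\<close>

lemma superlevel_in_subcomplex:
  assumes fin: "finite \<sigma>" and x: "x \<in> closed_simplex \<sigma>" and v: "cut_level A x < x v"
  shows "{v. cut_level A x < x v} \<in> A"
proof (rule ccontr)
  let ?\<tau> = "{v. cut_level A x < x v}"
  assume notin: "?\<tau> \<notin> A"
  have "?\<tau> \<subseteq> \<sigma>"
    using cut_level_nonneg[OF fin x, of A] closed_simplexD(2)[OF x] by force
  then have fin\<tau>: "finite ?\<tau>" using fin finite_subset by blast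
  have "Min (x ` ?\<tau>) \<le> cut_level A x"
    unfolding cut_level_on_simplex[OF fin x, of A]
    using fin notin v \<open>?\<tau> \<subseteq> \<sigma>\<close> unfolding cut_level_on_simplex[OF fin x, of A]
    by (intro Max_ge) auto
  moreover have "Min (x ` ?\<tau>) > cut_level A x"
    using fin\<tau> v by (subst Min_gr_iff) auto
  ultimately show False by simp
qed

lemma realisation_subset_push_nbhd:
  assumes A: "abstract_simplicial_complex A" and "A \<subseteq> K"
  shows "realisation_carrier A \<subseteq> push_nbhd K A"
proof
  fix x assume x: "x \<in> realisation_carrier A"
  let ?S = "{v. x v \<noteq> 0}"
  have S: "?S \<in> A" using x by (rule realisation_carrierD)
  then obtain v where "v \<in> ?S" using A unfolding abstract_simplicial_complex_def by blast
  have "{\<tau>. \<tau> \<subseteq> ?S \<and> \<tau> \<noteq> {} \<and> \<tau> \<notin> A} = {}"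
    using simplex_face[OF A S] by blast
  then have "cut_level A x = 0"
    unfolding cut_level_def by (simp only:) simp
  moreover have "0 < x v"
    using \<open>v \<in> ?S\<close> x by (auto simp: realisation_carrier_def order_less_le)
  moreover have "x \<in> realisation_carrier K"
    using x \<open>A \<subseteq> K\<close> by (auto simp: realisation_carrier_def)
  ultimately show "x \<in> push_nbhd K A"
    by (auto simp: push_nbhd_def)
qed

lemma continuous_on_Max_image:
  fixes f :: "'i \<Rightarrow> 'x::topological_space \<Rightarrow> real"
  assumes "finite I" "I \<noteq> {}" "\<And>i. i \<in> I \<Longrightarrow> continuous_on S (f i)"
  shows "continuous_on S (\<lambda>x. Max ((\<lambda>i. f i x) ` I))"
  using assms
proof (induction rule: finite_ne_induct)
  case (singleton i)
  have "continuous_on S (f i)" by (rule singleton.prems) simp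
  then show ?case by simp
next
  case (insert i I)
  then have "continuous_on S (\<lambda>x. max (f i x) (Max ((\<lambda>i. f i x) ` I)))"
    by (intro continuous_on_max) auto
  then show ?case using insert.hyps by simp
qed

lemma continuous_on_Min_image:
  fixes f :: "'i \<Rightarrow> 'x::topological_space \<Rightarrow> real"
  assumes "finite I" "I \<noteq> {}" "\<And>i. i \<in> I \<Longrightarrow> continuous_on S (f i)"
  shows "continuous_on S (\<lambda>x. Min ((\<lambda>i. f i x) ` I))"
  using assms
proof (induction rule: finite_ne_induct)
  case (singleton i)
  have "continuous_on S (f i)" by (rule singleton.prems) simp
  then show ?case by simp
next
  case (insert i I)
  then have "continuous_on S (\<lambda>x. min (f i x) (Min ((\<lambda>i. f i x) ` I)))"
    by (intro continuous_on_min) auto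
  then show ?case using insert.hyps by simp
qed

lemma continuous_on_cut_level:
  assumes fin: "finite \<sigma>"
  shows "continuous_on (closed_simplex \<sigma>) (cut_level A)"
proof -
  let ?T = "{\<tau>. \<tau> \<subseteq> \<sigma> \<and> \<tau> \<noteq> {} \<and> \<tau> \<notin> A}"
  have finT: "finite ?T" using fin by simp
  have Min: "continuous_on (closed_simplex \<sigma>) (\<lambda>x. Min (x ` \<tau>))" if "\<tau> \<in> ?T" for \<tau>
  proof -
    have "finite \<tau>" using that fin finite_subset by blast
    then show ?thesis
      using that
      by (intro continuous_on_Min_image[where f = "\<lambda>v x. x v", OF _ _ continuous_on_coordinate]) auto
  qed
  have "continuous_on (closed_simplex \<sigma>) (\<lambda>x. Max (insert 0 ((\<lambda>\<tau>. Min (x ` \<tau>)) ` ?T)))"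
  proof (cases "?T = {}")
    case True
    then show ?thesis by (simp only: image_empty) simp
  next
    case False
    have "continuous_on (closed_simplex \<sigma>) (\<lambda>x. max 0 (Max ((\<lambda>\<tau>. Min (x ` \<tau>)) ` ?T)))"
      by (rule continuous_on_max[OF continuous_on_const continuous_on_Max_image[OF finT False Min]])
    moreover have "Max (insert 0 ((\<lambda>\<tau>. Min (x ` \<tau>)) ` ?T)) = max 0 (Max ((\<lambda>\<tau>. Min (x ` \<tau>)) ` ?T))"
      for x :: "'a \<Rightarrow> real"
      using finT False by (subst Max_insert) auto
    ultimately show ?thesis by presburger
  qed
  then show ?thesis
    by (rule continuous_on_eq) (simp add: cut_level_on_simplex[OF fin])
qed

lemma openin_push_nbhd:
  assumes K: "abstract_simplicial_complex K"
  shows "openin (geometric_realisation K) (push_nbhd K A)"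
  unfolding openin_geometric_realisation
proof (intro conjI ballI)
  show "push_nbhd K A \<subseteq> realisation_carrier K" by (auto simp: push_nbhd_def)
  fix \<sigma> assume \<sigma>: "\<sigma> \<in> K"
  let ?S = "closed_simplex \<sigma>"
  have "openin (top_of_set ?S) (\<Union>v. ?S \<inter> (\<lambda>x. x v - cut_level A x) -` {0<..})"
  proof (rule openin_Union, clarify)
    fix v
    have "continuous_on ?S (\<lambda>x. x v - cut_level A x)"
      by (intro continuous_on_diff continuous_on_coordinate
          continuous_on_cut_level finite_simplex[OF K \<sigma>])
    then show "openin (top_of_set ?S) (?S \<inter> (\<lambda>x. x v - cut_level A x) -` {0<..})"
      by (rule continuous_openin_preimage_gen) simp
  qed
  moreover have "(\<Union>v. ?S \<inter> (\<lambda>x. x v - cut_level A x) -` {0<..}) = push_nbhd K A \<inter> ?S"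
    using closed_simplex_subset_realisation_carrier[OF K \<sigma>] by (auto simp: push_nbhd_def)
  ultimately show "openin (top_of_set ?S) (push_nbhd K A \<inter> ?S)" by simp
qed

text \<open>As for the level, the normalising sum may run over a simplex that does not depend on \<open>x\<close>:
  vertices outside the support contribute \<open>max 0 (- s * c) = 0\<close>.\<close>

lemma push_on_simplex:
  assumes fin: "finite \<sigma>" and x: "x \<in> closed_simplex \<sigma>" and s: "0 \<le> s"
  shows "push A s x v = max 0 (x v - s * cut_level A x) / (\<Sum>w\<in>\<sigma>. max 0 (x w - s * cut_level A x))"
proof -
  have "(\<Sum>w | x w \<noteq> 0. max 0 (x w - s * cut_level A x)) = (\<Sum>w\<in>\<sigma>. max 0 (x w - s * cut_level A x))"
    using x fin s cut_level_nonneg[OF fin x, of A]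
    by (intro sum.mono_neutral_left) (auto dest: closed_simplexD)
  then show ?thesis by (simp add: push_def)
qed

lemma push_denominator_pos:
  assumes fin: "finite \<sigma>" and x: "x \<in> closed_simplex \<sigma>" and s: "s \<in> {0..1}"
    and nbhd: "x \<in> push_nbhd K A"
  shows "0 < (\<Sum>w\<in>\<sigma>. max 0 (x w - s * cut_level A x))"
proof -
  note c = cut_level_nonneg[OF fin x, of A]
  obtain v where v: "cut_level A x < x v" using nbhd by (auto simp: push_nbhd_def)
  have "v \<in> \<sigma>" using v c closed_simplexD(2)[OF x, of v] by fastforce
  have "s * cut_level A x \<le> cut_level A x" using s c by (simp add: mult_left_le_one_le)
  then have "0 < max 0 (x v - s * cut_level A x)" using v by simp
  then show ?thesis
    using \<open>v \<in> \<sigma>\<close> fin by (intro sum_pos2[of _ v]) auto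
qed

lemma push_in_simplex:
  assumes fin: "finite \<sigma>" and x: "x \<in> closed_simplex \<sigma>" and s: "s \<in> {0..1}"
    and nbhd: "x \<in> push_nbhd K A"
  shows "push A s x \<in> closed_simplex \<sigma>"
proof (rule closed_simplexI)
  have s0: "0 \<le> s" using s by simp
  note pos = push_denominator_pos[OF assms] and eq = push_on_simplex[OF fin x s0]
  show "0 \<le> push A s x v" for v
    unfolding eq using pos by simp
  show "push A s x v = 0" if "v \<notin> \<sigma>" for v
    unfolding eq using closed_simplexD(2)[OF x that] cut_level_nonneg[OF fin x, of A] s0 by simp
  show "(\<Sum>v\<in>\<sigma>. push A s x v) = 1"
    unfolding eq using pos by (simp flip: sum_divide_distrib)
qed

lemma continuous_on_push:
  assumes fin: "finite \<sigma>"
  shows "continuous_on ({0..1} \<times> (push_nbhd K A \<inter> closed_simplex \<sigma>)) (\<lambda>p. push A (fst p) (snd p))"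
proof (rule continuous_on_coordinatewise_then_product)
  fix v
  let ?D = "{0..1::real} \<times> (push_nbhd K A \<inter> closed_simplex \<sigma>)"
  have c: "continuous_on ?D (\<lambda>p. cut_level A (snd p))"
    by (rule continuous_on_compose2[OF continuous_on_cut_level[OF fin] continuous_on_snd]) auto
  have coord: "continuous_on ?D (\<lambda>p. snd p w)" for w
    by (rule continuous_on_product_then_coordinatewise) (intro continuous_intros)
  have "continuous_on ?D (\<lambda>p. max 0 (snd p v - fst p * cut_level A (snd p))
      / (\<Sum>w\<in>\<sigma>. max 0 (snd p w - fst p * cut_level A (snd p))))"
  proof (intro continuous_on_divide continuous_on_sum continuous_on_max continuous_on_diff
      continuous_on_mult continuous_on_const c coord continuous_on_fst continuous_on_id ballI)
    fix p assume "p \<in> ?D"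
    then show "(\<Sum>w\<in>\<sigma>. max 0 (snd p w - fst p * cut_level A (snd p))) \<noteq> 0"
      using push_denominator_pos[OF fin, of "snd p" "fst p" K A] by auto
  qed
  then show "continuous_on ?D (\<lambda>p. push A (fst p) (snd p) v)"
    by (rule continuous_on_eq) (auto simp: push_on_simplex[OF fin])
qed

lemma push_0:
  assumes "x \<in> realisation_carrier K"
  shows "push A 0 x = x"
  using assms by (auto simp: push_def realisation_carrier_def)

text \<open>At time \<open>1\<close> precisely the vertices above the cut level survive, and these span a simplex of \<open>A\<close>.
  The simplex \<open>\<tau>\<close> is found among the finitely many faces of \<open>\<sigma>\<close>, as is needed to apply
  \<open>continuous_map_cylinder\<close>.\<close>

lemma push_1_carried:
  assumes fin: "finite \<sigma>" and x: "x \<in> closed_simplex \<sigma>" and nbhd: "x \<in> push_nbhd K A"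
  shows "\<exists>\<tau>\<in>A. \<tau> \<subseteq> \<sigma> \<and> push A 1 x \<in> closed_simplex \<tau>"
proof -
  define \<tau> where "\<tau> = {v. cut_level A x < x v}"
  have "\<tau> \<in> A"
    using superlevel_in_subcomplex[OF fin x] nbhd by (auto simp: \<tau>_def push_nbhd_def)
  have "\<tau> \<subseteq> \<sigma>"
    using cut_level_nonneg[OF fin x, of A] closed_simplexD(2)[OF x] by (force simp: \<tau>_def)
  have in\<sigma>: "push A 1 x \<in> closed_simplex \<sigma>"
    using push_in_simplex[OF fin x _ nbhd] by simp
  have zero: "push A 1 x v = 0" if "v \<notin> \<tau>" for v
    using that by (simp add: push_def \<tau>_def)
  then have "(\<Sum>v\<in>\<tau>. push A 1 x v) = (\<Sum>v\<in>\<sigma>. push A 1 x v)"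
    using fin \<open>\<tau> \<subseteq> \<sigma>\<close> by (intro sum.mono_neutral_left) auto
  then have "push A 1 x \<in> closed_simplex \<tau>"
    using zero in\<sigma> by (intro closed_simplexI) (auto dest: closed_simplexD)
  then show ?thesis using \<open>\<tau> \<in> A\<close> \<open>\<tau> \<subseteq> \<sigma>\<close> by blast
qed

section \<open>Homotopies on the neighbourhood of a subcomplex\<close>

text \<open>The deformation moves the points of \<open>|\<sigma>|\<close> inside \<open>|\<sigma>|\<close>. As \<open>\<phi>\<close> is simplicial on all of \<open>K\<close>, the
  single closed simplex on \<open>\<phi> ` \<sigma>\<close> carries the composed homotopy there.\<close>

lemma homotopic_push:
  assumes K: "abstract_simplicial_complex K" and L: "abstract_simplicial_complex L"
    and \<phi>: "simplicial_map K L \<phi>"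
  shows "homotopic_with (\<lambda>_. True) (subtopology (geometric_realisation K) (push_nbhd K A))
    (geometric_realisation L) (realisation_map \<phi>) (\<lambda>x. realisation_map \<phi> (push A 1 x))"
proof -
  define h where "h = (\<lambda>p. realisation_map \<phi> (push A (fst p) (snd p)))"
  have "continuous_map (prod_topology (top_of_set {0..1})
      (subtopology (geometric_realisation K) (push_nbhd K A))) (geometric_realisation L) h"
  proof (rule continuous_map_cylinder[OF K L openin_push_nbhd[OF K]])
    fix \<sigma> assume \<sigma>: "\<sigma> \<in> K"
    note fin = finite_simplex[OF K \<sigma>]
    let ?D = "{0..1::real} \<times> (push_nbhd K A \<inter> closed_simplex \<sigma>)"
    have im: "(\<lambda>p. push A (fst p) (snd p)) ` ?D \<subseteq> closed_simplex \<sigma>"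
      using push_in_simplex[OF fin] by auto
    show "continuous_on ?D h"
      unfolding h_def by (rule continuous_on_realisation_map_compose[OF fin continuous_on_push[OF fin] im])
    have "h ` ?D \<subseteq> closed_simplex (\<phi> ` \<sigma>)"
      using im realisation_map_in_simplex[OF fin, of _ \<phi>] by (auto simp: h_def image_subset_iff)
    moreover have "\<phi> ` \<sigma> \<in> L" using \<phi> \<sigma> by (auto simp: simplicial_map_def)
    ultimately show "\<exists>F. finite F \<and> F \<subseteq> L \<and> h ` ?D \<subseteq> (\<Union>\<rho>\<in>F. closed_simplex \<rho>)"
      by (intro exI[of _ "{\<phi> ` \<sigma>}"]) simp
  qed
  moreover have "h (0, x) = realisation_map \<phi> x"
    if "x \<in> topspace (subtopology (geometric_realisation K) (push_nbhd K A))" for x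
    using that by (simp add: h_def push_0[of x K] topspace_geometric_realisation[OF K])
  ultimately show ?thesis
    by (subst homotopic_with) (auto simp: h_def intro!: exI[of _ h])
qed

text \<open>Once pushed into a simplex \<open>\<tau>\<close> of \<open>A\<close>, a point has its images under both maps in the simplex spanned
  by \<open>\<phi> ` \<tau> \<union> \<psi> ` \<tau>\<close>, which belongs to \<open>L\<close> by contiguity, and the straight segment between the
  images stays in it. Contiguity is assumed on \<open>A\<close> only, since the intermediate maps of a contiguity class
  on \<open>A\<close> need not be simplicial on \<open>K\<close>.\<close>

lemma homotopic_contiguous:
  assumes K: "abstract_simplicial_complex K" and L: "abstract_simplicial_complex L"
    and cont: "contiguous A L \<phi> \<psi>"
  shows "homotopic_with (\<lambda>_. True) (subtopology (geometric_realisation K) (push_nbhd K A))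
    (geometric_realisation L) (\<lambda>x. realisation_map \<phi> (push A 1 x)) (\<lambda>x. realisation_map \<psi> (push A 1 x))"
proof -
  define h where "h = (\<lambda>p w. (1 - fst p) * realisation_map \<phi> (push A 1 (snd p)) w
    + fst p * realisation_map \<psi> (push A 1 (snd p)) w)"
  have "continuous_map (prod_topology (top_of_set {0..1})
      (subtopology (geometric_realisation K) (push_nbhd K A))) (geometric_realisation L) h"
  proof (rule continuous_map_cylinder[OF K L openin_push_nbhd[OF K]])
    fix \<sigma> assume \<sigma>: "\<sigma> \<in> K"
    note fin = finite_simplex[OF K \<sigma>]
    let ?D = "{0..1::real} \<times> (push_nbhd K A \<inter> closed_simplex \<sigma>)"
    have im: "(\<lambda>p. push A 1 (snd p)) ` ?D \<subseteq> closed_simplex \<sigma>"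
      using push_in_simplex[OF fin] by auto
    have "continuous_on ?D (\<lambda>p. (1::real, snd p))"
      by (intro continuous_intros)
    then have push: "continuous_on ?D (\<lambda>p. push A 1 (snd p))"
      using continuous_on_compose2[OF continuous_on_push[OF fin, of K A], of ?D "\<lambda>p. (1, snd p)"]
      by force
    have map: "continuous_on ?D (\<lambda>p. realisation_map \<theta> (push A 1 (snd p)) w)" for \<theta> :: "'a \<Rightarrow> 'b" and w
      by (rule continuous_on_product_then_coordinatewise)
        (rule continuous_on_realisation_map_compose[OF fin push im])
    show "continuous_on ?D h"
      unfolding h_def
      by (intro continuous_on_coordinatewise_then_product continuous_on_add continuous_on_mult
          continuous_on_diff continuous_on_const continuous_on_fst continuous_on_id map)
    define F where "F = (\<lambda>\<tau>. \<phi> ` \<tau> \<union> \<psi> ` \<tau>) ` {\<tau>\<in>A. \<tau> \<subseteq> \<sigma>}"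
    have "finite F" using fin by (auto simp: F_def)
    moreover have "F \<subseteq> L" using cont by (auto simp: F_def contiguous_def)
    moreover have "h ` ?D \<subseteq> (\<Union>\<rho>\<in>F. closed_simplex \<rho>)"
    proof (rule image_subsetI)
      fix p assume p: "p \<in> ?D"
      then obtain \<tau> where \<tau>: "\<tau> \<in> A" "\<tau> \<subseteq> \<sigma>" "push A 1 (snd p) \<in> closed_simplex \<tau>"
        using push_1_carried[OF fin, of "snd p" K A] by auto
      have fin\<tau>: "finite \<tau>" using \<tau> fin finite_subset by blast
      have "realisation_map \<phi> (push A 1 (snd p)) \<in> closed_simplex (\<phi> ` \<tau> \<union> \<psi> ` \<tau>)"
        "realisation_map \<psi> (push A 1 (snd p)) \<in> closed_simplex (\<phi> ` \<tau> \<union> \<psi> ` \<tau>)"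
        using realisation_map_in_simplex[OF fin\<tau> \<tau>(3)] fin\<tau>
          closed_simplex_mono[of "\<phi> ` \<tau> \<union> \<psi> ` \<tau>"] by blast+
      then have "h p \<in> closed_simplex (\<phi> ` \<tau> \<union> \<psi> ` \<tau>)"
        unfolding h_def using p by (intro closed_simplex_convex) auto
      then show "h p \<in> (\<Union>\<rho>\<in>F. closed_simplex \<rho>)" using \<tau> by (auto simp: F_def)
    qed
    ultimately show "\<exists>F. finite F \<and> F \<subseteq> L \<and> h ` ?D \<subseteq> (\<Union>\<rho>\<in>F. closed_simplex \<rho>)"
      by blast
  qed
  then show ?thesis
    by (subst homotopic_with) (auto simp: h_def intro!: exI[of _ h])
qed

lemma homotopic_same_contiguity_class:
  assumes K: "abstract_simplicial_complex K" and L: "abstract_simplicial_complex L"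
    and same: "same_contiguity_class A L \<phi> \<psi>"
  shows "homotopic_with (\<lambda>_. True) (subtopology (geometric_realisation K) (push_nbhd K A))
    (geometric_realisation L) (\<lambda>x. realisation_map \<phi> (push A 1 x)) (\<lambda>x. realisation_map \<psi> (push A 1 x))"
proof -
  have "(contiguous A L)\<^sup>*\<^sup>* \<phi> \<psi>" and \<phi>: "simplicial_map A L \<phi>"
    using same by (auto simp: same_contiguity_class_def)
  then show ?thesis
  proof (induction rule: rtranclp_induct)
    case base
    \<comment> \<open>Even the trivial sequence asks for the continuity of the composed map, which the constant
      homotopy between contiguous maps supplies.\<close>
    have "contiguous A L \<phi> \<phi>" using \<phi> by (simp add: contiguous_def simplicial_map_def)
    then show ?case by (rule homotopic_contiguous[OF K L])
  next
    case (step \<theta> \<theta>')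
    then show ?case using homotopic_contiguous[OF K L] homotopic_with_trans by blast
  qed
qed

theorem proposition3p10:
  fixes K :: "'a set set" and L :: "'b set set"
    and n :: nat and \<phi> :: "nat \<Rightarrow> 'a \<Rightarrow> 'b"
  assumes "abstract_simplicial_complex K" and "abstract_simplicial_complex L"
    and "\<And>i. i \<in> {1..n} \<Longrightarrow> simplicial_map K L (\<phi> i)"
  shows "homotopic_distance (geometric_realisation K) (geometric_realisation L) n
           (\<lambda>i. realisation_map (\<phi> i))
         \<le> contiguity_distance K L n \<phi>"
  unfolding homotopic_distance_def contiguity_distance_def
proof (rule Inf_superset_mono, rule subsetI, elim CollectE exE conjE, rule CollectI)
  fix d k and C :: "nat \<Rightarrow> 'a set set"
  assume d: "d = enat k" and sub: "\<forall>j\<le>k. subcomplex (C j) K" and cover: "(\<Union>j\<le>k. C j) = K"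
    and same: "\<forall>j\<le>k. \<forall>p\<in>{1..n}. \<forall>q\<in>{1..n}. same_contiguity_class (C j) L (\<phi> p) (\<phi> q)"
  define U where "U = (\<lambda>j. push_nbhd K (C j))"
  have "\<forall>j\<le>k. openin (geometric_realisation K) (U j)"
    using openin_push_nbhd[OF assms(1)] by (simp add: U_def)
  moreover have "(\<Union>j\<le>k. U j) = topspace (geometric_realisation K)"
    unfolding topspace_geometric_realisation[OF assms(1)]
  proof
    show "(\<Union>j\<le>k. U j) \<subseteq> realisation_carrier K" by (auto simp: U_def push_nbhd_def)
    show "realisation_carrier K \<subseteq> (\<Union>j\<le>k. U j)"
    proof
      fix x assume x: "x \<in> realisation_carrier K"
      then obtain j where j: "j \<le> k" "{v. x v \<noteq> 0} \<in> C j"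
        using cover realisation_carrierD(1) by blast
      then have "x \<in> realisation_carrier (C j)"
        using x by (simp add: realisation_carrier_def)
      then have "x \<in> U j"
        using sub j(1) realisation_subset_push_nbhd[of "C j" K] by (auto simp: U_def subcomplex_def)
      then show "x \<in> (\<Union>j\<le>k. U j)" using j by blast
    qed
  qed
  moreover have "homotopic_with (\<lambda>_. True) (subtopology (geometric_realisation K) (U j))
      (geometric_realisation L) (realisation_map (\<phi> p)) (realisation_map (\<phi> q))"
    if "j \<le> k" "p \<in> {1..n}" "q \<in> {1..n}" for j p q
  proof -
    note push = homotopic_push[OF assms(1,2) assms(3), of _ "C j"]
    have "same_contiguity_class (C j) L (\<phi> p) (\<phi> q)" using same that by blast
    from homotopic_same_contiguity_class[OF assms(1,2) this]
    show ?thesis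
      unfolding U_def
      using push[OF that(2)] push[OF that(3)] homotopic_with_trans homotopic_with_symD by blast
  qed
  ultimately show "\<exists>k'. d = enat k' \<and> (\<exists>U. (\<forall>j\<le>k'. openin (geometric_realisation K) (U j)) \<and>
      (\<Union>j\<le>k'. U j) = topspace (geometric_realisation K) \<and>
      (\<forall>j\<le>k'. \<forall>p\<in>{1..n}. \<forall>q\<in>{1..n}. homotopic_with (\<lambda>_. True)
        (subtopology (geometric_realisation K) (U j)) (geometric_realisation L)
        (realisation_map (\<phi> p)) (realisation_map (\<phi> q))))"
    using d by blast
qed

end
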